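(* For all pairs of twin binary trees $J_0$ and $J_1$, the product of $\mathbf{Baxter}$ satisfies $$\mathbf{P}_{J_0} \cdot \mathbf{P}_{J_1} = \sum_{J_0 / J_1 \,\leq_{\mathrm{B}}\, J \,\leq_{\mathrm{B}}\, J_0 \backslash J_1} \mathbf{P}_J .$$
   Context: $\mathbb{K}$ is a field of characteristic zero. $\mathfrak{S}$ is the set of all permutations (of all sizes $n\ge0$), seen as words; $\mathrm{std}(u)$ is the unique permutation of size $|u|$ with the same inversions as $u$. $\mathbf{FQSym}$ is the Hopf algebra over $\mathbb{K}$ with basis $\{\mathbf{F}_\sigma\}_{\sigma\in\mathfrak{S}}$, product $\mathbf{F}_\sigma\cdot\mathbf{F}_\nu = \sum_{\pi} \mathbf{F}_\pi$, where $\pi$ runs over all shuffles of $\sigma$ with the word obtained by adding $|\sigma|$ to every letter of $\nu$, and coproduct $\Delta(\mathbf{F}_\sigma) = \sum_{\sigma = uv} \mathbf{F}_{\mathrm{std}(u)} \otimes \mathbf{F}_{\mathrm{std}(v)}$. A binary tree is either a leaf (empty tree) or a node with a left and a right binary subtree. The canopy of a binary tree with $n$ nodes is the word of length $n-1$ obtained by reading its leaves from left to right except the first and the last, writing $0$ if the leaf is a right child and $1$ if it is a left child. A pair of twin binary trees is a pair of binary trees with the same number $n$ of nodes whose canopies differ at every position $1\le i\le n-1$. For a permutation $\sigma$, $\mathsf{P}(\sigma) = (T_L,T_R)$ where $T_L$ (resp. $T_R$) is the shape of the binary search tree obtained by inserting the letters of $\sigma$ from left to right (resp. right to left) with the standard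 binary search tree leaf insertion. $\mathbf{Baxter}$ is the Hopf subalgebra of $\mathbf{FQSym}$ with basis $\{\mathbf{P}_J\}$ indexed by pairs of twin binary trees, where $\mathbf{P}_J = \sum_{\sigma\in\mathfrak{S},\ \mathsf{P}(\sigma) = J} \mathbf{F}_\sigma$. The permutohedron order $\leq_{\mathrm{P}}$ on permutations of size $n$ is the partial order in which $\sigma$ is covered by $\nu$ iff $\sigma = u\,ab\,v$ and $\nu = u\,ba\,v$ for some words $u,v$ and letters $a<b$. The Baxter order on pairs of twin binary trees with $n$ nodes is defined by $J_0 \leq_{\mathrm{B}} J_1$ iff there are permutations $\sigma \leq_{\mathrm{P}} \nu$ of size $n$ with $\mathsf{P}(\sigma) = J_0$ and $\mathsf{P}(\nu) = J_1$. For binary trees $T_0,T_1$, $T_0 / T_1$ is obtained by grafting $T_0$ from its root on the leftmost leaf of $T_1$, and $T_0 \backslash T_1$ by grafting $T_1$ from its root on the rightmost leaf of $T_0$. For pairs of twin binary trees $J_0 = (T^0_L,T^0_R)$ and $J_1 = (T^1_L,T^1_R)$, $J_0 / J_1 := (T^0_L \backslash T^1_L,\ T^0_R / T^1_R)$ and $J_0 \backslash J_1 := (T^0_L / T^1_L,\ T^0_R \backslash T^1_R)$; these are pairs of twin binary trees. *)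

theory Defs
  imports
    "HOL-Combinatorics.Multiset_Permutations"
    "HOL-Library.Poly_Mapping"
    "HOL-Library.Tree"
begin

section \<open>Permutations as words\<close>

typedef perm_word = "\<Union>n. permutations_of_set {1..n::nat}"
  morphisms letters Perm_Word
  by (auto intro!: exI[of _ 0])

inductive perm_covered :: "perm_word \<Rightarrow> perm_word \<Rightarrow> bool" where
  "a < b \<Longrightarrow> letters \<sigma> = u @ [a, b] @ v \<Longrightarrow> letters \<nu> = u @ [b, a] @ v
    \<Longrightarrow> perm_covered \<sigma> \<nu>"

text \<open>
  The permutohedron order is generated by its covering relation, which only relates permutations
  of the same size.
\<close>

definition perm_le :: "perm_word \<Rightarrow> perm_word \<Rightarrow> bool"  (infix "\<le>\<^sub>P" 50) where
  "\<sigma> \<le>\<^sub>P \<nu> \<longleftrightarrow> perm_covered\<^sup>*\<^sup>* \<sigma> \<nu>"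


section \<open>The algebra FQSym\<close>

type_synonym 'k fqsym = "perm_word \<Rightarrow>\<^sub>0 'k"

definition fqsym_F :: "perm_word \<Rightarrow> 'k::field_char_0 fqsym" where
  "fqsym_F \<sigma> = Poly_Mapping.single \<sigma> 1"

text \<open>
  The two shuffled words have disjoint alphabets, so every shuffle arises exactly once and a set
  of shuffles suffices.
\<close>

definition shifted_shuffles :: "perm_word \<Rightarrow> perm_word \<Rightarrow> perm_word set" where
  "shifted_shuffles \<sigma> \<nu> =
     {\<pi>. letters \<pi> \<in> shuffles (letters \<sigma>) (map (\<lambda>i. i + length (letters \<sigma>)) (letters \<nu>))}"

text \<open>The bilinear extension of the product of basis elements; see \<open>fqsym_F_mult_F\<close> below.\<close>

definition fqsym_mult :: "'k::field_char_0 fqsym \<Rightarrow> 'k fqsym \<Rightarrow> 'k fqsym"  (infixl "\<cdot>" 70) where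
  "x \<cdot> y = (\<Sum>\<sigma>\<in>Poly_Mapping.keys x. \<Sum>\<nu>\<in>Poly_Mapping.keys y. \<Sum>\<pi>\<in>shifted_shuffles \<sigma> \<nu>.
     Poly_Mapping.single \<pi> (Poly_Mapping.lookup x \<sigma> * Poly_Mapping.lookup y \<nu>))"

lemma fqsym_F_mult_F: "fqsym_F \<sigma> \<cdot> fqsym_F \<nu> = (\<Sum>\<pi>\<in>shifted_shuffles \<sigma> \<nu>. fqsym_F \<pi>)"
  by (simp add: fqsym_mult_def fqsym_F_def)

text \<open>No shuffle is lost by letting \<open>\<pi>\<close> range over the type of permutations.\<close>

lemma letters_shifted_shuffles:
  "letters ` shifted_shuffles \<sigma> \<nu> =
     shuffles (letters \<sigma>) (map (\<lambda>i. i + length (letters \<sigma>)) (letters \<nu>))"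
proof -
  have *: "w \<in> range letters \<longleftrightarrow> distinct w \<and> set w = {1..length w}" for w
  proof -
    have "range letters = (\<Union>n. permutations_of_set {1..n})"
      using type_definition.Rep_range[OF type_definition_perm_word] .
    then have "w \<in> range letters \<longleftrightarrow> (\<exists>n. set w = {1..n} \<and> distinct w)"
      by (simp add: permutations_of_set_def)
    also have "\<dots> \<longleftrightarrow> distinct w \<and> set w = {1..length w}"
      by (metis card_atLeastAtMost diff_Suc_1 distinct_card)
    finally show ?thesis .
  qed
  have perm: "distinct (letters \<tau>)" "set (letters \<tau>) = {1..length (letters \<tau>)}" for \<tau>
    using *[of "letters \<tau>"] by simp_all
  have "w \<in> range letters"
    if w: "w \<in> shuffles (letters \<sigma>) (map (\<lambda>i. i + length (letters \<sigma>)) (letters \<nu>))" for w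
  proof -
    let ?n = "length (letters \<sigma>)" and ?m = "length (letters \<nu>)"
    have im: "set (map (\<lambda>i. i + ?n) (letters \<nu>)) = {1 + ?n..?m + ?n}"
      unfolding set_map perm(2) by (rule image_add_atLeastAtMost')
    have dm: "distinct (map (\<lambda>i. i + ?n) (letters \<nu>))"
      using perm(1) by (simp add: distinct_map)
    have disj: "set (letters \<sigma>) \<inter> set (map (\<lambda>i. i + ?n) (letters \<nu>)) = {}"
      unfolding im unfolding perm(2)[of \<sigma>] by auto
    have "distinct w"
      by (rule distinct_disjoint_shuffles[OF perm(1) dm disj w])
    moreover have "set w = {1..?n} \<union> {1 + ?n..?m + ?n}"
      using set_shuffles[OF w] im perm(2)[of \<sigma>] by simp
    moreover have "{1..n} \<union> {1 + n..m + n} = {1..n + m}" for n m :: nat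
      by auto
    moreover have "length w = ?n + ?m"
      using length_shuffles[OF w] by simp
    ultimately show ?thesis
      unfolding * by (simp only:)
  qed
  then show ?thesis
    unfolding shifted_shuffles_def by (auto simp: image_iff)
qed


section \<open>Pairs of twin binary trees\<close>

type_synonym bin_tree = "unit tree"

text \<open>
  The directions of all leaves from left to right; the first argument is the direction of the
  root itself, which matters only for the empty tree.
\<close>

fun leaf_word :: "nat \<Rightarrow> bin_tree \<Rightarrow> nat list" where
  "leaf_word d Leaf = [d]"
| "leaf_word d (Node l _ r) = leaf_word 1 l @ leaf_word 0 r"

definition canopy :: "bin_tree \<Rightarrow> nat list" where
  "canopy t = butlast (tl (leaf_word 0 t))"

type_synonym tree_pair = "bin_tree \<times> bin_tree"

definition twin :: "tree_pair \<Rightarrow> bool" where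
  "twin J \<longleftrightarrow> size (fst J) = size (snd J) \<and>
     (\<forall>i < size (fst J) - 1. canopy (fst J) ! i \<noteq> canopy (snd J) ! i)"

fun bst_insert :: "nat \<Rightarrow> nat tree \<Rightarrow> nat tree" where
  "bst_insert x Leaf = Node Leaf x Leaf"
| "bst_insert x (Node l a r) =
     (if x \<le> a then Node (bst_insert x l) a r else Node l a (bst_insert x r))"

definition shape :: "'a tree \<Rightarrow> bin_tree" where
  "shape t = map_tree (\<lambda>_. ()) t"

definition P_symbol :: "perm_word \<Rightarrow> tree_pair" where
  "P_symbol \<sigma> = (shape (fold bst_insert (letters \<sigma>) Leaf),
                shape (fold bst_insert (rev (letters \<sigma>)) Leaf))"

text \<open>The element of FQSym indexed by a pair of twin binary trees; the sum is finite.\<close>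

definition baxter_P :: "tree_pair \<Rightarrow> 'k::field_char_0 fqsym" where
  "baxter_P J = (\<Sum>\<sigma> | P_symbol \<sigma> = J. fqsym_F \<sigma>)"

definition baxter_le :: "tree_pair \<Rightarrow> tree_pair \<Rightarrow> bool"  (infix "\<le>\<^sub>B" 50) where
  "J\<^sub>0 \<le>\<^sub>B J\<^sub>1 \<longleftrightarrow> (\<exists>\<sigma> \<nu>. \<sigma> \<le>\<^sub>P \<nu> \<and> P_symbol \<sigma> = J\<^sub>0 \<and> P_symbol \<nu> = J\<^sub>1)"

text \<open>\<open>tree_over T\<^sub>0 T\<^sub>1\<close> is $T_0 / T_1$ and \<open>tree_under T\<^sub>0 T\<^sub>1\<close> is $T_0 \backslash T_1$.\<close>

fun tree_over :: "bin_tree \<Rightarrow> bin_tree \<Rightarrow> bin_tree" where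
  "tree_over t Leaf = t"
| "tree_over t (Node l x r) = Node (tree_over t l) x r"

fun tree_under :: "bin_tree \<Rightarrow> bin_tree \<Rightarrow> bin_tree" where
  "tree_under Leaf t = t"
| "tree_under (Node l x r) t = Node l x (tree_under r t)"

definition twin_over :: "tree_pair \<Rightarrow> tree_pair \<Rightarrow> tree_pair" where
  "twin_over J\<^sub>0 J\<^sub>1 = (tree_under (fst J\<^sub>0) (fst J\<^sub>1), tree_over (snd J\<^sub>0) (snd J\<^sub>1))"

definition twin_under :: "tree_pair \<Rightarrow> tree_pair \<Rightarrow> tree_pair" where
  "twin_under J\<^sub>0 J\<^sub>1 = (tree_over (fst J\<^sub>0) (fst J\<^sub>1), tree_under (snd J\<^sub>0) (snd J\<^sub>1))"

end

theory Submission
  imports Defs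
begin

text \<open>
  In the binary search tree of a word \<open>w\<close>, a letter \<open>b > a\<close> lies in the right subtree of \<open>a\<close> iff
  \<open>a\<close> precedes every letter of \<open>{a<..b}\<close> in \<open>w\<close>. The set of all such pairs \<open>(a, b)\<close> determines the
  shape of the tree, is monotone along the permutohedron order (with opposite directions for the
  two components of the P-symbol), and restricts to intervals of letters. The trees of \<open>J\<^sub>0 / J\<^sub>1\<close> and
  \<open>J\<^sub>0 \ J\<^sub>1\<close> only differ in pairs joining a small letter to a large one. Hence every permutation
  whose P-symbol lies between them restricts, on the small and on the large letters, to permutations
  with P-symbols \<open>J\<^sub>0\<close> and \<open>J\<^sub>1\<close>, that is, it is a shifted shuffle of such permutations. Conversely a
  shifted shuffle of \<open>\<sigma>\<close> and \<open>\<nu>\<close> lies between the two concatenations, whose P-symbols are the ends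
  of the interval.
\<close>

section \<open>Relative order of letters in a word\<close>

text \<open>Recursion on arbitrary words keeps appending, filtering and reversal free of
  distinctness assumptions; on a distinct word this is the strict order of positions.\<close>

primrec before :: "'a list \<Rightarrow> 'a \<Rightarrow> 'a \<Rightarrow> bool" where
  "before [] a c \<longleftrightarrow> False"
| "before (x # w) a c \<longleftrightarrow> x = a \<and> c \<in> set w \<or> before w a c"

lemma before_in_set: "before w a c \<Longrightarrow> a \<in> set w \<and> c \<in> set w"
  by (induction w) auto

lemma before_append:
  "before (u @ v) a c \<longleftrightarrow> before u a c \<or> before v a c \<or> a \<in> set u \<and> c \<in> set v"
  by (induction u) auto

lemma before_filter: "before (filter Q w) a c \<longleftrightarrow> before w a c \<and> Q a \<and> Q c"
  by (induction w) (auto dest: before_in_set)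

lemma before_rev: "before (rev w) a c \<longleftrightarrow> before w c a"
  by (induction w) (auto simp: before_append)

section \<open>Adjacent transpositions and shuffles\<close>

lemma append_in_shuffles: "u @ v \<in> shuffles u v"
  by (induction u) (auto intro: Cons_in_shuffles_leftI)

text \<open>The covering relation on bare words: inductions remove the first letter, and what
  remains is in general no longer a permutation of an initial segment.\<close>

definition adjacent_swap :: "'a::linorder list \<Rightarrow> 'a list \<Rightarrow> bool" where
  "adjacent_swap x y \<longleftrightarrow> (\<exists>u v a b. a < b \<and> x = u @ [a, b] @ v \<and> y = u @ [b, a] @ v)"

lemma adjacent_swap_Cons: "adjacent_swap x y \<Longrightarrow> adjacent_swap (z # x) (z # y)"
  unfolding adjacent_swap_def by (metis append_Cons)

lemma adjacent_swaps_Cons: "adjacent_swap\<^sup>*\<^sup>* x y \<Longrightarrow> adjacent_swap\<^sup>*\<^sup>* (z # x) (z # y)"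
  by (induction rule: rtranclp_induct) (auto intro: adjacent_swap_Cons rtranclp.rtrancl_into_rtrancl)

lemma adjacent_swap_hd: "a < b \<Longrightarrow> adjacent_swap (a # b # w) (b # a # w)"
  unfolding adjacent_swap_def by (metis append_Cons append_Nil)

lemma adjacent_swaps_move_right:
  "\<forall>y \<in> set v. x < y \<Longrightarrow> adjacent_swap\<^sup>*\<^sup>* (x # v @ w) (v @ x # w)"
proof (induction v)
  case (Cons y v)
  then have "adjacent_swap\<^sup>*\<^sup>* (y # x # v @ w) (y # v @ x # w)"
    by (simp add: adjacent_swaps_Cons)
  moreover have "adjacent_swap (x # y # v @ w) (y # x # v @ w)"
    using Cons.prems by (simp add: adjacent_swap_hd)
  ultimately show ?case
    by (metis append_Cons converse_rtranclp_into_rtranclp)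
qed simp

lemma adjacent_swaps_move_left:
  "\<forall>x \<in> set u. x < y \<Longrightarrow> adjacent_swap\<^sup>*\<^sup>* (u @ y # w) (y # u @ w)"
proof (induction u)
  case (Cons x u)
  then have "adjacent_swap\<^sup>*\<^sup>* (x # u @ y # w) (x # y # u @ w)"
    by (simp add: adjacent_swaps_Cons)
  moreover have "adjacent_swap (x # y # u @ w) (y # x # u @ w)"
    using Cons.prems by (simp add: adjacent_swap_hd)
  ultimately show ?case
    by (metis append_Cons rtranclp.rtrancl_into_rtrancl)
qed simp

text \<open>Whichever word supplies the first letter of the shuffle, one of the two bounds is
  inherited from the rest. For the other bound that letter crosses the whole opposite word:
  \<open>x\<close> moves right past \<open>v\<close>, or \<open>y\<close> moves left past
  \<open>u\<close>.\<close>

lemma adjacent_swaps_shuffle: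
  assumes "w \<in> shuffles u v" "\<forall>x \<in> set u. \<forall>y \<in> set v. x < y"
  shows "adjacent_swap\<^sup>*\<^sup>* (u @ v) w \<and> adjacent_swap\<^sup>*\<^sup>* w (v @ u)"
  using assms
proof (induction u v arbitrary: w rule: shuffles.induct)
  case (3 x xs y ys)
  from "3.prems"(1) consider
      w' where "w = x # w'" "w' \<in> shuffles xs (y # ys)"
    | w' where "w = y # w'" "w' \<in> shuffles (x # xs) ys"
    by auto
  then show ?case
  proof cases
    case 1
    with "3.IH"(1) "3.prems"(2) have
      "adjacent_swap\<^sup>*\<^sup>* (xs @ y # ys) w'" "adjacent_swap\<^sup>*\<^sup>* w' ((y # ys) @ xs)" by auto
    moreover have "adjacent_swap\<^sup>*\<^sup>* (x # (y # ys) @ xs) ((y # ys) @ x # xs)"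
      using "3.prems"(2) by (intro adjacent_swaps_move_right) auto
    ultimately show ?thesis unfolding 1(1)
      using adjacent_swaps_Cons rtranclp_trans by (metis append_Cons)
  next
    case 2
    with "3.IH"(2) "3.prems"(2) have
      "adjacent_swap\<^sup>*\<^sup>* ((x # xs) @ ys) w'" "adjacent_swap\<^sup>*\<^sup>* w' (ys @ x # xs)" by auto
    moreover have "adjacent_swap\<^sup>*\<^sup>* ((x # xs) @ y # ys) (y # (x # xs) @ ys)"
      using "3.prems"(2) by (intro adjacent_swaps_move_left) auto
    ultimately show ?thesis unfolding 2(1)
      using adjacent_swaps_Cons rtranclp_trans by (metis append_Cons)
  qed
qed auto


section \<open>The permutohedron order\<close>

lemma range_letters: "w \<in> range letters \<longleftrightarrow> distinct w \<and> set w = {1..length w}"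
proof -
  have "range letters = (\<Union>n. permutations_of_set {1..n})"
    using type_definition.Rep_range[OF type_definition_perm_word] .
  then have "w \<in> range letters \<longleftrightarrow> (\<exists>n. set w = {1..n} \<and> distinct w)"
    by (simp add: permutations_of_set_def)
  also have "\<dots> \<longleftrightarrow> distinct w \<and> set w = {1..length w}"
    by (metis card_atLeastAtMost diff_Suc_1 distinct_card)
  finally show ?thesis .
qed

lemma distinct_letters [simp]: "distinct (letters \<sigma>)"
  and set_letters: "set (letters \<sigma>) = {1..length (letters \<sigma>)}"
  using range_letters[of "letters \<sigma>"] by simp_all

lemma finite_perm_words_of_length: "finite {\<sigma>. length (letters \<sigma>) = n}"
proof (rule finite_imageD)
  have "letters ` {\<sigma>. length (letters \<sigma>) = n} \<subseteq> {w. set w \<subseteq> {1..n} \<and> length w = n}"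
    using set_letters by auto
  then show "finite (letters ` {\<sigma>. length (letters \<sigma>) = n})"
    by (rule finite_subset) (simp add: finite_lists_length_eq)
qed (meson inj_onI letters_inject)

lemma perm_covered_iff: "perm_covered \<sigma> \<nu> \<longleftrightarrow> adjacent_swap (letters \<sigma>) (letters \<nu>)"
  unfolding perm_covered.simps adjacent_swap_def by blast

text \<open>Swaps preserve the multiset of letters, so a chain that starts at a permutation consists
  of permutations and lifts to \<open>perm_word\<close>.\<close>

lemma adjacent_swaps_imp_perm_le:
  "adjacent_swap\<^sup>*\<^sup>* (letters \<sigma>) w \<Longrightarrow> \<exists>\<nu>. w = letters \<nu> \<and> \<sigma> \<le>\<^sub>P \<nu>"
proof (induction rule: rtranclp_induct)
  case base
  then show ?case by (auto simp: perm_le_def)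
next
  case (step y z)
  then obtain \<nu> where \<nu>: "y = letters \<nu>" "\<sigma> \<le>\<^sub>P \<nu>" by blast
  from step(2) have "mset z = mset y" by (auto simp: adjacent_swap_def)
  then have "z \<in> range letters"
    using range_letters \<nu>(1) by (metis mset_eq_imp_distinct_iff mset_eq_length mset_eq_setD rangeI)
  then obtain \<tau> where "z = letters \<tau>" by blast
  with \<nu> step(2) show ?case
    unfolding perm_le_def by (metis perm_covered_iff rtranclp.rtrancl_into_rtrancl)
qed

lemma perm_le_length: "\<sigma> \<le>\<^sub>P \<nu> \<Longrightarrow> length (letters \<sigma>) = length (letters \<nu>)"
  unfolding perm_le_def by (induction rule: rtranclp_induct) (auto elim: perm_covered.cases)

text \<open>A covering step reverses a single pair, increasing at the bottom and decreasing at the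
  top, so every non-inversion of the upper permutation is already one of the lower.\<close>

lemma perm_le_before:
  assumes "\<sigma> \<le>\<^sub>P \<nu>" "a < b" "before (letters \<nu>) a b"
  shows "before (letters \<sigma>) a b"
  using assms unfolding perm_le_def
  by (induction rule: rtranclp_induct)
    (auto elim!: perm_covered.cases simp: before_append)

lemma before_letters_total:
  assumes "a \<in> set (letters \<sigma>)" "c \<in> set (letters \<sigma>)" "a \<noteq> c"
  shows "before (letters \<sigma>) a c \<longleftrightarrow> \<not> before (letters \<sigma>) c a"
proof -
  have "a \<in> set w \<Longrightarrow> c \<in> set w \<Longrightarrow> distinct w \<Longrightarrow> before w a c \<longleftrightarrow> \<not> before w c a" for w
    using assms(3) by (induction w) (auto dest: before_in_set)
  with assms show ?thesis by simp
qed


section \<open>Right descendants in binary trees\<close>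

text \<open>
  The nodes are numbered in symmetric order starting from \<open>p\<close>; the pair \<open>(a, b)\<close> is present iff
  \<open>b\<close> lies in the right subtree of \<open>a\<close>.
\<close>

primrec right_pairs :: "nat \<Rightarrow> 'a tree \<Rightarrow> (nat \<times> nat) set" where
  "right_pairs p Leaf = {}"
| "right_pairs p (Node l x r) =
     right_pairs p l \<union> {p + size l} \<times> {p + size l<..p + size l + size r}
       \<union> right_pairs (Suc (p + size l)) r"

lemma right_pairs_bounds:
  "(a, b) \<in> right_pairs p t \<Longrightarrow> p \<le> a \<and> a < b \<and> b < p + size t"
proof (induction t arbitrary: p)
  case (Node l x r)
  show ?case
    using Node.prems Node.IH(1)[of p] Node.IH(2)[of "Suc (p + size l)"] by auto
qed simp

text \<open>The root of the first tree is paired with the last node. If \<open>l'\<close> were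
  larger than \<open>l\<close>, this root position would lie inside \<open>l'\<close>, whose pairs
  do not reach the last node.\<close>

lemma right_pairs_size_left:
  assumes "right_pairs p (Node l x r) = right_pairs p (Node l' x' r')"
    "size (Node l x r) = size (Node l' x' r')"
  shows "size l' \<le> size l"
proof (rule ccontr)
  assume less: "\<not> size l' \<le> size l"
  with assms(2) have "(p + size l, p + size l + size r) \<in> right_pairs p (Node l x r)"
    by auto
  then have "(p + size l, p + size l + size r) \<in> right_pairs p (Node l' x' r')"
    unfolding assms(1) .
  with less assms(2) show False
    by (auto dest!: right_pairs_bounds)
qed

text \<open>The size of the left subtree is recovered first; the pairs wholly below or wholly above
  the root position are then those of the two subtrees. Sizes must be given, since the empty tree
  and the single node both have no pairs.\<close>

lemma right_pairs_inject:
  fixes t t' :: bin_tree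
  assumes "right_pairs p t = right_pairs p t'" "size t = size t'"
  shows "t = t'"
  using assms
proof (induction t arbitrary: p t')
  case Leaf
  then show ?case by simp
next
  case (Node l x r)
  then obtain l' r' where t': "t' = Node l' () r'"
    by (cases t') auto
  note eq = Node.prems[unfolded t']
  have sl: "size l = size l'"
    using right_pairs_size_left[OF eq] right_pairs_size_left[OF eq[symmetric]] by simp
  with eq have sr: "size r = size r'" by simp
  let ?s = "p + size l"
  have "right_pairs p l = {(a, b) \<in> right_pairs p (Node l x r). b < ?s}"
    by (auto dest: right_pairs_bounds)
  also have "\<dots> = right_pairs p l'"
    unfolding eq(1) by (auto simp: sl dest: right_pairs_bounds)
  finally have "l = l'" using Node.IH(1) sl by blast
  have "right_pairs (Suc ?s) r = {(a, b) \<in> right_pairs p (Node l x r). a > ?s}"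
    by (auto dest: right_pairs_bounds)
  also have "\<dots> = right_pairs (Suc ?s) r'"
    unfolding eq(1) by (auto simp: sl dest: right_pairs_bounds)
  finally have "r = r'" using Node.IH(2) sr by blast
  with \<open>l = l'\<close> t' show ?case by simp
qed

section \<open>Right descendants under grafting\<close>

lemma size_tree_over [simp]: "size (tree_over t\<^sub>0 t\<^sub>1) = size t\<^sub>0 + size t\<^sub>1"
  by (induction t\<^sub>1) auto

lemma size_tree_under [simp]: "size (tree_under t\<^sub>0 t\<^sub>1) = size t\<^sub>0 + size t\<^sub>1"
  by (induction t\<^sub>0) auto

text \<open>Every node of \<open>t\<^sub>1\<close> above the graft has it in its left subtree, so no
  right descendants are added.\<close>

lemma right_pairs_tree_over:
  "right_pairs p (tree_over t\<^sub>0 t\<^sub>1) = right_pairs p t\<^sub>0 \<union> right_pairs (p + size t\<^sub>0) t\<^sub>1"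
  by (induction t\<^sub>1) (simp_all add: add.assoc Un_assoc)

text \<open>The nodes on the right spine of \<open>t\<^sub>0\<close> gain all of
  \<open>t\<^sub>1\<close> as right descendants. Of these new pairs \<open>X\<close> only the
  location is recorded: from the first block of nodes into the second.\<close>

lemma right_pairs_tree_under:
  "\<exists>X \<subseteq> {..<p + size t\<^sub>0} \<times> {p + size t\<^sub>0..}.
     right_pairs p (tree_under t\<^sub>0 t\<^sub>1) = right_pairs p t\<^sub>0 \<union> X \<union> right_pairs (p + size t\<^sub>0) t\<^sub>1"
proof (induction t\<^sub>0 arbitrary: p)
  case Leaf
  show ?case by auto
next
  case (Node l x r)
  let ?s = "p + size l"
  obtain X where X: "X \<subseteq> {..<Suc ?s + size r} \<times> {Suc ?s + size r..}"
    "right_pairs (Suc ?s) (tree_under r t\<^sub>1) =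
       right_pairs (Suc ?s) r \<union> X \<union> right_pairs (Suc ?s + size r) t\<^sub>1"
    using Node.IH(2) by blast
  let ?Y = "{?s} \<times> {?s + size r<..?s + size r + size t\<^sub>1} \<union> X"
  have split: "{?s} \<times> {?s<..?s + (size r + size t\<^sub>1)} =
      {?s} \<times> {?s<..?s + size r} \<union> {?s} \<times> {?s + size r<..?s + size r + size t\<^sub>1}"
    by auto
  have size: "p + size (Node l x r) = Suc ?s + size r" by simp
  have "?Y \<subseteq> {..<p + size (Node l x r)} \<times> {p + size (Node l x r)..}"
    unfolding size using X(1) by auto
  moreover have "right_pairs p (tree_under (Node l x r) t\<^sub>1) =
      right_pairs p (Node l x r) \<union> ?Y \<union> right_pairs (p + size (Node l x r)) t\<^sub>1"
    unfolding size tree_under.simps right_pairs.simps size_tree_under split X(2) by blast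
  ultimately show ?case by blast
qed

text \<open>Together with the analogue for \<open>tree_under\<close>, this shows that the two grafts
  agree inside each block of nodes, so a relation squeezed between them is determined there.\<close>

lemma right_pairs_tree_over_restrict:
  "right_pairs p (tree_over t\<^sub>0 t\<^sub>1) \<inter> {(a, b). b < p + size t\<^sub>0} = right_pairs p t\<^sub>0"
  "right_pairs p (tree_over t\<^sub>0 t\<^sub>1) \<inter> {(a, b). p + size t\<^sub>0 \<le> a} = right_pairs (p + size t\<^sub>0) t\<^sub>1"
  unfolding right_pairs_tree_over by (auto dest: right_pairs_bounds)

lemma right_pairs_tree_under_restrict:
  "right_pairs p (tree_under t\<^sub>0 t\<^sub>1) \<inter> {(a, b). b < p + size t\<^sub>0} = right_pairs p t\<^sub>0"
  "right_pairs p (tree_under t\<^sub>0 t\<^sub>1) \<inter> {(a, b). p + size t\<^sub>0 \<le> a} = right_pairs (p + size t\<^sub>0) t\<^sub>1"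
proof -
  obtain X where X: "X \<subseteq> {..<p + size t\<^sub>0} \<times> {p + size t\<^sub>0..}"
    "right_pairs p (tree_under t\<^sub>0 t\<^sub>1) = right_pairs p t\<^sub>0 \<union> X \<union> right_pairs (p + size t\<^sub>0) t\<^sub>1"
    using right_pairs_tree_under[of p t\<^sub>0 t\<^sub>1] by blast
  define n where "n = p + size t\<^sub>0"
  have low: "a < n \<and> b < n" if "(a, b) \<in> right_pairs p t\<^sub>0" for a b
    using right_pairs_bounds[OF that] by (simp add: n_def)
  have high: "n \<le> a \<and> n \<le> b" if "(a, b) \<in> right_pairs n t\<^sub>1" for a b
    using right_pairs_bounds[OF that] by simp
  have cross: "a < n \<and> n \<le> b" if "(a, b) \<in> X" for a b
    using X(1) that by (auto simp: n_def)
  show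
    "right_pairs p (tree_under t\<^sub>0 t\<^sub>1) \<inter> {(a, b). b < p + size t\<^sub>0} = right_pairs p t\<^sub>0"
    "right_pairs p (tree_under t\<^sub>0 t\<^sub>1) \<inter> {(a, b). p + size t\<^sub>0 \<le> a} = right_pairs (p + size t\<^sub>0) t\<^sub>1"
    unfolding X(2) unfolding n_def[symmetric]
    by (auto dest: low high cross)
qed

section \<open>Canopies in terms of right descendants\<close>

lemma length_leaf_word [simp]: "length (leaf_word d t) = Suc (size t)"
  by (induction d t rule: leaf_word.induct) auto

lemma leaf_word_first: "t \<noteq> Leaf \<Longrightarrow> leaf_word d t ! 0 = 1"
proof (induction d t rule: leaf_word.induct)
  case (2 d l x r)
  then show ?case by (cases l) (auto simp: nth_append)
qed simp

lemma leaf_word_last: "t \<noteq> Leaf \<Longrightarrow> leaf_word d t ! size t = 0"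
proof (induction d t rule: leaf_word.induct)
  case (2 d l x r)
  then show ?case by (cases r) (auto simp: nth_append)
qed simp

text \<open>The leaf between two consecutive nodes is the left child of the second if that node lies
  in the right subtree of the first, and otherwise the right child of the first. The cases are: a
  leaf inside \<open>l\<close>, the last leaf of \<open>l\<close>, the first leaf of
  \<open>r\<close>, a later leaf of \<open>r\<close>.\<close>

lemma leaf_word_inner:
  "Suc i < size t \<Longrightarrow> leaf_word d t ! Suc i = of_bool ((p + i, Suc (p + i)) \<in> right_pairs p t)"
proof (induction t arbitrary: d i p)
  case (Node l x r)
  let ?s = "size l"
  consider "Suc i < ?s" | "Suc i = ?s" | "i = ?s" | "?s < i" by linarith
  then show ?case
  proof cases
    case 1
    then have "(p + i, Suc (p + i)) \<notin> right_pairs (Suc (p + ?s)) r"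
      by (auto dest: right_pairs_bounds)
    with 1 show ?thesis
      using Node.IH(1)[of i 1 p] by (simp add: nth_append)
  next
    case 2
    then have "l \<noteq> Leaf" by auto
    with 2 have "leaf_word 1 l ! Suc i = 0" using leaf_word_last[of l 1] by simp
    moreover from 2 have "(p + i, Suc (p + i)) \<notin> right_pairs p l"
      "(p + i, Suc (p + i)) \<notin> right_pairs (Suc (p + ?s)) r"
      by (auto dest: right_pairs_bounds)
    ultimately show ?thesis using 2 by (simp add: nth_append)
  next
    case 3
    with Node.prems have "r \<noteq> Leaf" by auto
    then have "leaf_word 0 r ! 0 = 1" "0 < size r"
      using leaf_word_first[of r 0] by (simp_all add: eq_size_0 neq0_conv[symmetric])
    with 3 show ?thesis by (simp add: nth_append)
  next
    case 4
    then obtain j where j: "i = Suc ?s + j" using less_iff_Suc_add by auto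
    then have "leaf_word 0 r ! Suc j =
        of_bool ((Suc (p + ?s) + j, Suc (Suc (p + ?s) + j)) \<in> right_pairs (Suc (p + ?s)) r)"
      using Node.IH(2)[of j 0 "Suc (p + ?s)"] Node.prems by simp
    moreover from j have "(p + i, Suc (p + i)) \<notin> right_pairs p l"
      by (auto dest: right_pairs_bounds)
    ultimately show ?thesis using j by (simp add: nth_append add.assoc)
  qed
qed simp

lemma canopy_nth:
  assumes "i < size t - 1"
  shows "canopy t ! i = of_bool ((p + i, Suc (p + i)) \<in> right_pairs p t)"
proof -
  have "canopy t ! i = leaf_word 0 t ! Suc i"
    using assms by (simp add: canopy_def nth_butlast nth_tl)
  with leaf_word_inner[of i t 0 p] assms show ?thesis by simp
qed


section \<open>Shapes of binary search trees\<close>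

definition bst_shape :: "nat list \<Rightarrow> bin_tree" where
  "bst_shape w = shape (fold bst_insert w Leaf)"

lemma P_symbol_eq: "P_symbol \<sigma> = (bst_shape (letters \<sigma>), bst_shape (rev (letters \<sigma>)))"
  by (simp add: P_symbol_def bst_shape_def)

lemma bst_shape_Nil [simp]: "bst_shape [] = Leaf"
  by (simp add: bst_shape_def shape_def)

text \<open>The root never changes and the letters sent to one side do not affect the other, so an
  insertion sequence splits into two independent ones.\<close>

lemma fold_bst_insert_Node:
  "fold bst_insert w (Node l a r) =
     Node (fold bst_insert (filter (\<lambda>x. x \<le> a) w) l) a (fold bst_insert (filter (\<lambda>x. a < x) w) r)"
  by (induction w arbitrary: l r) auto

lemma bst_shape_Cons:
  assumes "x \<notin> set w"
  shows "bst_shape (x # w) =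
    Node (bst_shape (filter (\<lambda>y. y < x) w)) () (bst_shape (filter (\<lambda>y. x < y) w))"
proof -
  have "filter (\<lambda>y. y \<le> x) w = filter (\<lambda>y. y < x) w"
    using assms by (intro filter_cong) (auto simp: le_less)
  then show ?thesis by (simp add: bst_shape_def shape_def fold_bst_insert_Node)
qed

lemma size_bst_shape [simp]: "distinct w \<Longrightarrow> size (bst_shape w) = length w"
proof (induction w rule: length_induct)
  case (1 w)
  show ?case
  proof (cases w)
    case (Cons x v)
    have "filter (\<lambda>y. x < y) v = filter (\<lambda>y. \<not> y < x) v"
      using 1 Cons by (intro filter_cong) (auto simp: not_less le_less)
    moreover have "length (filter (\<lambda>y. y < x) v) < length w" "length (filter (\<lambda>y. x < y) v) < length w"
      using Cons by (simp_all add: le_imp_less_Suc)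
    ultimately show ?thesis
      using 1 Cons sum_length_filter_compl[of "\<lambda>y. y < x" v] by (simp add: bst_shape_Cons)
  qed simp
qed

lemma bst_shape_map_add: "bst_shape (map (\<lambda>i. i + n) w) = bst_shape w"
proof -
  have insert: "bst_insert (x + n) (map_tree (\<lambda>i. i + n) t) = map_tree (\<lambda>i. i + n) (bst_insert x t)"
    for x t by (induction t) auto
  have "fold bst_insert (map (\<lambda>i. i + n) w) (map_tree (\<lambda>i. i + n) t) =
      map_tree (\<lambda>i. i + n) (fold bst_insert w t)" for t
    by (induction w arbitrary: t) (auto simp: insert)
  from this[of Leaf] show ?thesis
    by (simp add: bst_shape_def shape_def tree.map_comp o_def)
qed

text \<open>The letters of \<open>v\<close> arrive last and exceed all of \<open>u\<close>, so each
  descends the right spine to the rightmost leaf. The induction is on length because the right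
  subtree comes from a filtered tail.\<close>

lemma bst_shape_append_greater:
  assumes "distinct u" "distinct v" "\<forall>x \<in> set u. \<forall>y \<in> set v. x < y"
  shows "bst_shape (u @ v) = tree_under (bst_shape u) (bst_shape v)"
  using assms
proof (induction u rule: length_induct)
  case (1 u)
  show ?case
  proof (cases u)
    case (Cons x u')
    have "filter (\<lambda>y. y < x) v = []" "filter (\<lambda>y. x < y) v = v" "x \<notin> set (u' @ v)"
      using 1 Cons by (auto simp: filter_empty_conv filter_id_conv)
    moreover have "length (filter (\<lambda>y. x < y) u') < length u"
      using Cons by (simp add: le_imp_less_Suc)
    ultimately show ?thesis using 1 Cons by (simp add: bst_shape_Cons)
  qed simp
qed

text \<open>Mirror image: the late, smaller letters all fall to the leftmost leaf.\<close>

lemma bst_shape_append_less: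
  assumes "distinct u" "distinct v" "\<forall>x \<in> set u. \<forall>y \<in> set v. x < y"
  shows "bst_shape (v @ u) = tree_over (bst_shape u) (bst_shape v)"
  using assms
proof (induction v rule: length_induct)
  case (1 v)
  show ?case
  proof (cases v)
    case (Cons x v')
    have "filter (\<lambda>y. y < x) u = u" "filter (\<lambda>y. x < y) u = []" "x \<notin> set (v' @ u)"
      using 1 Cons by (auto simp: filter_empty_conv filter_id_conv)
    moreover have "length (filter (\<lambda>y. y < x) v') < length v"
      using Cons by (simp add: le_imp_less_Suc)
    ultimately show ?thesis using 1 Cons by (simp add: bst_shape_Cons)
  qed simp
qed

section \<open>Right descendants read off from the word\<close>

definition first_pairs :: "nat list \<Rightarrow> (nat \<times> nat) set" where
  "first_pairs w = {(a, b). a < b \<and> (\<forall>c \<in> {a<..b}. before w a c)}"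

text \<open>The first letter \<open>x\<close> is the root. No pair has \<open>a < x\<close> and
  \<open>x \<le> b\<close>, since \<open>x\<close> precedes \<open>a\<close>; the pairs with
  \<open>a = x\<close> reach all larger letters; all others live in the subword of smaller or of
  larger letters, to which the induction hypothesis applies.\<close>

lemma right_pairs_bst_shape:
  assumes "distinct w" "set w = {p..<p + length w}"
  shows "right_pairs p (bst_shape w) = first_pairs w"
  using assms
proof (induction w arbitrary: p rule: length_induct)
  case (1 w)
  note assms_w = "1.prems"
  have IH: "right_pairs q (bst_shape v) = first_pairs v"
    if "length v < length w" "distinct v" "set v = {q..<q + length v}" for v q
    using "1.IH" that by blast
  show ?case
  proof (cases w)
    case Nil
    then show ?thesis by (auto simp: first_pairs_def)
  next
    case (Cons x v)
    let ?l = "filter (\<lambda>y. y < x) v" and ?r = "filter (\<lambda>y. x < y) v"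
    from assms_w Cons have v: "x \<notin> set v" "distinct v" and x: "p \<le> x" "x < p + length w"
      by auto
    have "set v = {p..<p + length w} - {x}"
      unfolding assms_w(2)[symmetric] using Cons v(1) by auto
    then have set_v: "c \<in> set v \<longleftrightarrow> p \<le> c \<and> c < p + length w \<and> c \<noteq> x" for c
      by auto
    have set_l: "set ?l = {p..<x}" and set_r: "set ?r = {Suc x..<p + length w}"
      using x by (auto simp: set_v)
    have len_l: "length ?l = x - p" and len_r: "length ?r = p + length w - Suc x"
      using set_l set_r v(2) distinct_card[of ?l] distinct_card[of ?r] by simp_all
    have l: "right_pairs p (bst_shape ?l) = first_pairs ?l"
      using Cons v(2) set_l len_l x by (intro IH) (simp_all add: le_imp_less_Suc)
    have r: "right_pairs (Suc x) (bst_shape ?r) = first_pairs ?r"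
      using Cons v(2) set_r len_r x by (intro IH) (simp_all add: le_imp_less_Suc)
    have "p + length ?l = x" "p + length ?l + length ?r = p + length w - 1"
      using len_l len_r x by simp_all
    then have "right_pairs p (bst_shape w) =
        first_pairs ?l \<union> {x} \<times> {x<..p + length w - 1} \<union> first_pairs ?r"
      unfolding Cons bst_shape_Cons[OF v(1)] right_pairs.simps using v(2) l r by simp
    also have "\<dots> = first_pairs w"
    proof -
      have before_w: "before w a c \<longleftrightarrow> x = a \<and> c \<in> set v \<or> before v a c" for a c
        using Cons by simp
      have not_before: "\<not> before v a x" "\<not> before v x c" for a c
        using v(1) before_in_set by metis+
      have "(a, b) \<in> first_pairs ?l \<union> {x} \<times> {x<..p + length w - 1} \<union> first_pairs ?r \<longleftrightarrow>
          (a, b) \<in> first_pairs w" for a b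
      proof (cases a x rule: linorder_cases)
        case less
        have "b < x" if "a < b" "\<forall>c \<in> {a<..b}. before v a c"
        proof (rule ccontr)
          assume "\<not> b < x"
          with less that have "before v a x" by simp
          with not_before show False by simp
        qed
        with less show ?thesis
          unfolding first_pairs_def before_filter before_w by auto
      next
        case equal
        \<comment> \<open>\<open>before\<close> demands that its second letter occurs in the word;
          this alone bounds \<open>b\<close> by the largest letter.\<close>
        have "(\<forall>c \<in> {x<..b}. c \<in> set v) \<longleftrightarrow> b < p + length w" if "x < b"
          using that x by (auto simp: set_v)
        with equal x not_before show ?thesis
          unfolding first_pairs_def before_filter before_w by auto
      next
        case greater
        then show ?thesis
          unfolding first_pairs_def before_filter before_w by auto
      qed
      then show ?thesis by (intro set_eqI) (simp only: split_paired_all)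
    qed
    finally show ?thesis .
  qed
qed

section \<open>Invariants of the P-symbol\<close>

lemma right_pairs_letters:
  "right_pairs 1 (bst_shape (letters \<sigma>)) = first_pairs (letters \<sigma>)"
  "right_pairs 1 (bst_shape (rev (letters \<sigma>))) = first_pairs (rev (letters \<sigma>))"
  by (rule right_pairs_bst_shape; simp add: set_letters atLeastLessThanSuc_atLeastAtMost)+

text \<open>For consecutive letters the pair criterion only says that the smaller one comes first,
  which holds for exactly one of a word and its reversal.\<close>

lemma twin_P_symbol: "twin (P_symbol \<sigma>)"
proof -
  have "canopy (bst_shape (letters \<sigma>)) ! i \<noteq> canopy (bst_shape (rev (letters \<sigma>))) ! i"
    if i: "i < length (letters \<sigma>) - 1" for i
  proof -
    have "(1 + i, Suc (1 + i)) \<in> first_pairs w \<longleftrightarrow> before w (1 + i) (Suc (1 + i))" for w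
      by (auto simp: first_pairs_def le_Suc_eq)
    moreover have "before (letters \<sigma>) (1 + i) (Suc (1 + i)) \<longleftrightarrow>
        \<not> before (rev (letters \<sigma>)) (1 + i) (Suc (1 + i))"
      unfolding before_rev using i by (intro before_letters_total) (auto simp: set_letters)
    ultimately show ?thesis
      using i by (simp add: canopy_nth[where p = 1] right_pairs_letters del: One_nat_def)
  qed
  then show ?thesis by (simp add: twin_def P_symbol_eq)
qed

lemma length_letters_eq: "length (letters \<sigma>) = size (fst (P_symbol \<sigma>))"
  by (simp add: P_symbol_eq)

lemma first_pairs_antimono:
  assumes "\<sigma> \<le>\<^sub>P \<nu>"
  shows "first_pairs (letters \<nu>) \<subseteq> first_pairs (letters \<sigma>)"
  using perm_le_before[OF assms] by (auto simp: first_pairs_def)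

text \<open>Inversions persist upwards: this is the contrapositive of \<open>perm_le_before\<close>,
  any two letters of a permutation being comparable by position.\<close>

lemma first_pairs_rev_mono:
  assumes "\<sigma> \<le>\<^sub>P \<nu>"
  shows "first_pairs (rev (letters \<sigma>)) \<subseteq> first_pairs (rev (letters \<nu>))"
proof -
  have "before (letters \<nu>) c a" if "before (letters \<sigma>) c a" "a < c" for a c
  proof -
    have mem: "a \<in> set (letters \<sigma>)" "c \<in> set (letters \<sigma>)"
      using before_in_set[OF that(1)] by simp_all
    then have "a \<in> set (letters \<nu>)" "c \<in> set (letters \<nu>)"
      using perm_le_length[OF assms] by (simp_all add: set_letters)
    with mem that perm_le_before[OF assms that(2)] show ?thesis
      using before_letters_total by (metis less_irrefl)
  qed
  then show ?thesis by (auto simp: first_pairs_def before_rev)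
qed

text \<open>The criterion for \<open>(a, b)\<close> only inspects letters between \<open>a\<close>
  and \<open>b\<close>, so deleting letters outside an interval containing both changes
  nothing.\<close>

lemma first_pairs_filter_le:
  "first_pairs (filter (\<lambda>x. x \<le> n) w) = first_pairs w \<inter> {(a, b). b \<le> n}"
  by (auto simp: first_pairs_def before_filter)

lemma first_pairs_filter_greater:
  "first_pairs (filter (\<lambda>x. n < x) w) = first_pairs w \<inter> {(a, b). n < a}"
  by (auto simp: first_pairs_def before_filter)

text \<open>Inside each block the lower and the upper bound coincide, which leaves freedom only in
  the pairs joining the blocks. The restricted relation is thus that of \<open>t\<^sub>0\<close> or
  \<open>t\<^sub>1\<close>, and \<open>right_pairs_inject\<close> gives the tree.\<close>

lemma bst_shape_restrict:
  assumes w: "distinct w" "set w = {1..size t\<^sub>0 + size t\<^sub>1}"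
    and lower: "right_pairs 1 (tree_over t\<^sub>0 t\<^sub>1) \<subseteq> first_pairs w"
    and upper: "first_pairs w \<subseteq> right_pairs 1 (tree_under t\<^sub>0 t\<^sub>1)"
  shows "bst_shape (filter (\<lambda>x. x \<le> size t\<^sub>0) w) = t\<^sub>0"
    and "bst_shape (filter (\<lambda>x. size t\<^sub>0 < x) w) = t\<^sub>1"
proof -
  let ?n = "size t\<^sub>0"
  let ?u = "filter (\<lambda>x. x \<le> ?n) w" and ?v = "filter (\<lambda>x. ?n < x) w"
  have set_u: "set ?u = {1..<1 + ?n}" and set_v: "set ?v = {1 + ?n..<1 + ?n + size t\<^sub>1}"
    using w(2) by auto
  then have len: "length ?u = ?n" "length ?v = size t\<^sub>1"
    using w(1) distinct_card[of ?u] distinct_card[of ?v] by simp_all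
  have "right_pairs 1 (bst_shape ?u) = first_pairs ?u"
    using w(1) set_u len by (intro right_pairs_bst_shape) simp_all
  also have "\<dots> = first_pairs w \<inter> {(a, b). b < 1 + ?n}"
    unfolding first_pairs_filter_le by auto
  also have "\<dots> = right_pairs 1 t\<^sub>0"
    using lower upper right_pairs_tree_over_restrict(1)[of 1 t\<^sub>0 t\<^sub>1]
      right_pairs_tree_under_restrict(1)[of 1 t\<^sub>0 t\<^sub>1] by blast
  finally show "bst_shape ?u = t\<^sub>0"
    using w(1) len by (intro right_pairs_inject) simp_all
  have "right_pairs (1 + ?n) (bst_shape ?v) = first_pairs ?v"
    using w(1) set_v len by (intro right_pairs_bst_shape) simp_all
  also have "\<dots> = first_pairs w \<inter> {(a, b). 1 + ?n \<le> a}"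
    unfolding first_pairs_filter_greater by auto
  also have "\<dots> = right_pairs (1 + ?n) t\<^sub>1"
    using lower upper right_pairs_tree_over_restrict(2)[of 1 t\<^sub>0 t\<^sub>1]
      right_pairs_tree_under_restrict(2)[of 1 t\<^sub>0 t\<^sub>1] by blast
  finally show "bst_shape ?v = t\<^sub>1"
    using w(1) len by (intro right_pairs_inject) simp_all
qed


section \<open>Shifted shuffles and intervals of the Baxter order\<close>

lemma shifted_less:
  "x \<in> set (letters \<sigma>) \<Longrightarrow> y \<in> set (map (\<lambda>i. i + length (letters \<sigma>)) (letters \<nu>)) \<Longrightarrow> x < y"
  by (auto simp: set_letters)

text \<open>Reversal exchanges the small and the large block, so the two components are grafted in
  opposite ways.\<close>

lemma P_symbol_append_shifted:
  "letters \<pi> = letters \<sigma> @ map (\<lambda>i. i + length (letters \<sigma>)) (letters \<nu>) \<Longrightarrow>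
     P_symbol \<pi> = twin_over (P_symbol \<sigma>) (P_symbol \<nu>)"
  "letters \<pi> = map (\<lambda>i. i + length (letters \<sigma>)) (letters \<nu>) @ letters \<sigma> \<Longrightarrow>
     P_symbol \<pi> = twin_under (P_symbol \<sigma>) (P_symbol \<nu>)"
proof -
  let ?u = "letters \<sigma>" and ?v = "map (\<lambda>i. i + length (letters \<sigma>)) (letters \<nu>)"
  have dist: "distinct ?v" by (simp add: distinct_map)
  have less: "\<forall>x \<in> set ?u. \<forall>y \<in> set ?v. x < y"
    "\<forall>x \<in> set (rev ?u). \<forall>y \<in> set (rev ?v). x < y"
    using shifted_less by simp_all
  have shape: "bst_shape ?v = bst_shape (letters \<nu>)"
    "bst_shape (rev ?v) = bst_shape (rev (letters \<nu>))"
    by (simp_all only: rev_map bst_shape_map_add)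
  show "P_symbol \<pi> = twin_over (P_symbol \<sigma>) (P_symbol \<nu>)" if "letters \<pi> = ?u @ ?v"
    using dist less unfolding P_symbol_eq twin_over_def that rev_append shape[symmetric]
    by (simp del: set_map add: bst_shape_append_greater bst_shape_append_less)
  show "P_symbol \<pi> = twin_under (P_symbol \<sigma>) (P_symbol \<nu>)" if "letters \<pi> = ?v @ ?u"
    using dist less unfolding P_symbol_eq twin_under_def that rev_append shape[symmetric]
    by (simp del: set_map add: bst_shape_append_greater bst_shape_append_less)
qed

lemma shifted_shuffle_in_interval:
  assumes "\<pi> \<in> shifted_shuffles \<sigma> \<nu>"
  shows "twin_over (P_symbol \<sigma>) (P_symbol \<nu>) \<le>\<^sub>B P_symbol \<pi>"
    and "P_symbol \<pi> \<le>\<^sub>B twin_under (P_symbol \<sigma>) (P_symbol \<nu>)"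
proof -
  let ?u = "letters \<sigma>" and ?v = "map (\<lambda>i. i + length (letters \<sigma>)) (letters \<nu>)"
  have "letters \<pi> \<in> shuffles ?u ?v" using assms by (simp add: shifted_shuffles_def)
  from adjacent_swaps_shuffle[OF this] shifted_less
  have swaps: "adjacent_swap\<^sup>*\<^sup>* (?u @ ?v) (letters \<pi>)" "adjacent_swap\<^sup>*\<^sup>* (letters \<pi>) (?v @ ?u)"
    by blast+
  have "?u @ ?v \<in> letters ` shifted_shuffles \<sigma> \<nu>"
    unfolding letters_shifted_shuffles by (rule append_in_shuffles)
  then obtain \<alpha> where \<alpha>: "letters \<alpha> = ?u @ ?v" by force
  with swaps(1) have "\<alpha> \<le>\<^sub>P \<pi>"
    using adjacent_swaps_imp_perm_le[of \<alpha>] by (metis letters_inject)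
  with P_symbol_append_shifted(1)[OF \<alpha>]
  show "twin_over (P_symbol \<sigma>) (P_symbol \<nu>) \<le>\<^sub>B P_symbol \<pi>"
    unfolding baxter_le_def by metis
  from adjacent_swaps_imp_perm_le[OF swaps(2)]
  obtain \<omega> where \<omega>: "letters \<omega> = ?v @ ?u" "\<pi> \<le>\<^sub>P \<omega>" by force
  from P_symbol_append_shifted(2)[OF \<omega>(1)] \<omega>(2)
  show "P_symbol \<pi> \<le>\<^sub>B twin_under (P_symbol \<sigma>) (P_symbol \<nu>)"
    unfolding baxter_le_def by metis
qed

lemma interval_imp_length:
  assumes "twin_over J\<^sub>0 J\<^sub>1 \<le>\<^sub>B P_symbol \<pi>"
  shows "length (letters \<pi>) = size (fst J\<^sub>0) + size (fst J\<^sub>1)"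
proof -
  obtain \<alpha> \<beta> where "\<alpha> \<le>\<^sub>P \<beta>" "P_symbol \<alpha> = twin_over J\<^sub>0 J\<^sub>1" "P_symbol \<beta> = P_symbol \<pi>"
    using assms unfolding baxter_le_def by blast
  then show ?thesis
    using perm_le_length[of \<alpha> \<beta>] by (simp add: length_letters_eq twin_over_def)
qed

lemma interval_imp_shifted_shuffle:
  assumes "twin J\<^sub>0" "twin J\<^sub>1"
    and over: "twin_over J\<^sub>0 J\<^sub>1 \<le>\<^sub>B P_symbol \<pi>" and under: "P_symbol \<pi> \<le>\<^sub>B twin_under J\<^sub>0 J\<^sub>1"
  shows "\<exists>\<sigma> \<nu>. P_symbol \<sigma> = J\<^sub>0 \<and> P_symbol \<nu> = J\<^sub>1 \<and> \<pi> \<in> shifted_shuffles \<sigma> \<nu>"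
proof -
  obtain l\<^sub>0 r\<^sub>0 l\<^sub>1 r\<^sub>1 where J: "J\<^sub>0 = (l\<^sub>0, r\<^sub>0)" "J\<^sub>1 = (l\<^sub>1, r\<^sub>1)" by fastforce
  let ?n = "size l\<^sub>0" and ?m = "size l\<^sub>1"
  have sizes: "size r\<^sub>0 = ?n" "size r\<^sub>1 = ?m"
    using assms(1,2) by (simp_all add: twin_def J)
  \<comment> \<open>\<open>\<beta>\<close> and \<open>\<gamma>\<close> need not be \<pi>; they only
    share its P-symbol. Hence all comparisons below pass through invariants of the P-symbol.\<close>
  obtain \<alpha> \<beta> where \<alpha>\<beta>: "\<alpha> \<le>\<^sub>P \<beta>" "P_symbol \<alpha> = twin_over J\<^sub>0 J\<^sub>1" "P_symbol \<beta> = P_symbol \<pi>"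
    using over unfolding baxter_le_def by blast
  obtain \<gamma> \<delta> where \<gamma>\<delta>: "\<gamma> \<le>\<^sub>P \<delta>" "P_symbol \<gamma> = P_symbol \<pi>" "P_symbol \<delta> = twin_under J\<^sub>0 J\<^sub>1"
    using under unfolding baxter_le_def by blast
  have left: "first_pairs (letters \<tau>) = right_pairs 1 (fst (P_symbol \<tau>))"
    and right: "first_pairs (rev (letters \<tau>)) = right_pairs 1 (snd (P_symbol \<tau>))" for \<tau>
    by (simp_all only: right_pairs_letters P_symbol_eq fst_conv snd_conv)
  have len: "length (letters \<pi>) = ?n + ?m"
    using interval_imp_length[OF over] by (simp add: J)
  then have set_\<pi>: "set (letters \<pi>) = {1..?n + ?m}" by (simp add: set_letters)

  \<comment> \<open>On left components \<open>first_pairs\<close> is antitone, so the smaller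
    relation comes from the upper end of the interval; for the reversed words below the roles are
    exchanged.\<close>
  have "right_pairs 1 (tree_over l\<^sub>0 l\<^sub>1) \<subseteq> first_pairs (letters \<pi>)"
    using first_pairs_antimono[OF \<gamma>\<delta>(1)] unfolding left \<gamma>\<delta>(2,3) by (simp add: J twin_under_def)
  moreover have "first_pairs (letters \<pi>) \<subseteq> right_pairs 1 (tree_under l\<^sub>0 l\<^sub>1)"
    using first_pairs_antimono[OF \<alpha>\<beta>(1)] unfolding left \<alpha>\<beta>(2,3) by (simp add: J twin_over_def)
  ultimately have shape_left:
    "bst_shape (filter (\<lambda>x. x \<le> ?n) (letters \<pi>)) = l\<^sub>0"
    "bst_shape (filter (\<lambda>x. ?n < x) (letters \<pi>)) = l\<^sub>1"
    using set_\<pi> by (auto intro!: bst_shape_restrict)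
  have "right_pairs 1 (tree_over r\<^sub>0 r\<^sub>1) \<subseteq> first_pairs (rev (letters \<pi>))"
    using first_pairs_rev_mono[OF \<alpha>\<beta>(1)] unfolding right \<alpha>\<beta>(2,3) by (simp add: J twin_over_def)
  moreover have "first_pairs (rev (letters \<pi>)) \<subseteq> right_pairs 1 (tree_under r\<^sub>0 r\<^sub>1)"
    using first_pairs_rev_mono[OF \<gamma>\<delta>(1)] unfolding right \<gamma>\<delta>(2,3) by (simp add: J twin_under_def)
  ultimately have shape_right:
    "bst_shape (filter (\<lambda>x. x \<le> ?n) (rev (letters \<pi>))) = r\<^sub>0"
    "bst_shape (filter (\<lambda>x. ?n < x) (rev (letters \<pi>))) = r\<^sub>1"
    using set_\<pi> bst_shape_restrict[of "rev (letters \<pi>)" r\<^sub>0 r\<^sub>1] by (simp_all add: sizes)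

  let ?u = "filter (\<lambda>x. x \<le> ?n) (letters \<pi>)" and ?v = "filter (\<lambda>x. ?n < x) (letters \<pi>)"
  \<comment> \<open>Truncated subtraction is exact here, as all letters of \<open>?v\<close> exceed
    \<open>?n\<close>.\<close>
  let ?v' = "map (\<lambda>x. x - ?n) ?v"
  have set_u: "set ?u = {1..?n}" and set_v: "set ?v = {?n + 1..?n + ?m}"
    using set_\<pi> by auto
  have len_uv: "length ?u = ?n" "length ?v = ?m"
    using set_u set_v distinct_card[of ?u] distinct_card[of ?v] by simp_all
  have "?u \<in> range letters"
    unfolding range_letters using set_u len_uv by simp
  then obtain \<sigma> where \<sigma>: "letters \<sigma> = ?u" by force
  have "inj_on (\<lambda>x. x - ?n) (set ?v)" by (auto intro!: inj_onI)
  then have "distinct ?v'" by (simp add: distinct_map)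
  moreover have "set ?v' = {1..?m}"
  proof -
    have "{?n + 1..?n + ?m} = (\<lambda>i. i + ?n) ` {1..?m}"
      by (simp add: image_add_atLeastAtMost' add.commute)
    then show ?thesis
      unfolding set_map set_v by (simp only: image_image diff_add_inverse2 image_ident)
  qed
  ultimately have "?v' \<in> range letters"
    unfolding range_letters using len_uv by simp
  then obtain \<nu> where \<nu>: "letters \<nu> = ?v'" by force
  have shifted: "map (\<lambda>i. i + ?n) (letters \<nu>) = ?v"
    unfolding \<nu> map_map by (rule map_idI) auto

  have "P_symbol \<sigma> = J\<^sub>0"
    using shape_left(1) shape_right(1) by (simp add: P_symbol_eq \<sigma> J rev_filter)
  moreover have "P_symbol \<nu> = J\<^sub>1"
    using shape_left(2) shape_right(2)
    unfolding P_symbol_eq J rev_filter[symmetric] shifted[symmetric] rev_map bst_shape_map_add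
    by simp
  moreover have "letters \<pi> \<in> shuffles ?u ?v"
    using partition_in_shuffles[of "letters \<pi>" "\<lambda>x. x \<le> ?n"] by (simp add: not_le)
  then have "\<pi> \<in> shifted_shuffles \<sigma> \<nu>"
    by (simp add: shifted_shuffles_def \<sigma> len_uv shifted)
  ultimately show ?thesis by blast
qed

text \<open>Once the length of the first factor is fixed, cutting the letters of \<pi> at that value
  recovers both factors. This makes the product multiplicity-free.\<close>

lemma shifted_shuffles_disjoint:
  assumes "\<pi> \<in> shifted_shuffles \<sigma> \<nu>" "\<pi> \<in> shifted_shuffles \<sigma>' \<nu>'"
    and len: "length (letters \<sigma>) = length (letters \<sigma>')"
  shows "\<sigma> = \<sigma>' \<and> \<nu> = \<nu>'"
proof -
  let ?n = "length (letters \<sigma>)"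
  have restrict: "filter (\<lambda>x. x \<le> ?n) (letters \<pi>) = letters \<tau> \<and>
      filter (\<lambda>x. \<not> x \<le> ?n) (letters \<pi>) = map (\<lambda>i. i + ?n) (letters \<rho>)"
    if "\<pi> \<in> shifted_shuffles \<tau> \<rho>" "length (letters \<tau>) = ?n" for \<tau> \<rho>
  proof -
    let ?v = "map (\<lambda>i. i + ?n) (letters \<rho>)"
    have "letters \<pi> \<in> shuffles (letters \<tau>) ?v"
      using that by (simp add: shifted_shuffles_def)
    moreover have "filter (\<lambda>x. x \<le> ?n) (letters \<tau>) = letters \<tau>"
      "filter (\<lambda>x. \<not> x \<le> ?n) (letters \<tau>) = []"
      "filter (\<lambda>x. x \<le> ?n) ?v = []" "filter (\<lambda>x. \<not> x \<le> ?n) ?v = ?v"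
      using that(2) by (auto simp: filter_id_conv filter_empty_conv set_letters)
    ultimately show ?thesis
      using filter_shuffles[of "\<lambda>x. x \<le> ?n" "letters \<tau>" ?v]
        filter_shuffles[of "\<lambda>x. \<not> x \<le> ?n" "letters \<tau>" ?v] by fastforce
  qed
  have "letters \<sigma> = letters \<sigma>'"
    "map (\<lambda>i. i + ?n) (letters \<nu>) = map (\<lambda>i. i + ?n) (letters \<nu>')"
    using restrict[OF assms(1)] restrict[OF assms(2)] len by simp_all
  moreover have "inj (map (\<lambda>i. i + ?n))" by (simp add: inj_on_def)
  ultimately show ?thesis by (simp add: letters_inject inj_eq)
qed


section \<open>The product of the Baxter algebra\<close>

text \<open>A sum over an infinite set would be 0 by convention, so the coefficients of
  \<open>baxter_P\<close> can only be read off after this.\<close>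

lemma finite_P_symbol_vimage: "finite {\<sigma>. P_symbol \<sigma> = J}"
  by (rule finite_subset[OF _ finite_perm_words_of_length[of "size (fst J)"]])
    (auto simp: length_letters_eq)

lemma finite_shifted_shuffles: "finite (shifted_shuffles \<sigma> \<nu>)"
  by (rule finite_imageD[of letters])
    (auto simp: letters_shifted_shuffles letters_inject intro: inj_onI)

lemma lookup_baxter_P:
  "Poly_Mapping.lookup (baxter_P J :: 'k::field_char_0 fqsym) \<sigma> = of_bool (P_symbol \<sigma> = J)"
  by (simp add: baxter_P_def fqsym_F_def Poly_Mapping.lookup_sum lookup_single when_def
      finite_P_symbol_vimage)

lemma keys_baxter_P:
  "Poly_Mapping.keys (baxter_P J :: 'k::field_char_0 fqsym) = {\<sigma>. P_symbol \<sigma> = J}"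
  by (auto simp: in_keys_iff lookup_baxter_P)

lemma baxter_P_mult:
  "(baxter_P J\<^sub>0 :: 'k::field_char_0 fqsym) \<cdot> baxter_P J\<^sub>1 =
    (\<Sum>\<sigma> | P_symbol \<sigma> = J\<^sub>0. \<Sum>\<nu> | P_symbol \<nu> = J\<^sub>1. \<Sum>\<pi>\<in>shifted_shuffles \<sigma> \<nu>. fqsym_F \<pi>)"
  unfolding fqsym_mult_def keys_baxter_P by (simp add: lookup_baxter_P fqsym_F_def)

theorem corollary6p7:
  fixes J\<^sub>0 J\<^sub>1 :: tree_pair
  assumes "twin J\<^sub>0" and "twin J\<^sub>1"
  shows "(baxter_P J\<^sub>0 :: 'k::field_char_0 fqsym) \<cdot> baxter_P J\<^sub>1 =
    (\<Sum>J | twin J \<and> twin_over J\<^sub>0 J\<^sub>1 \<le>\<^sub>B J \<and> J \<le>\<^sub>B twin_under J\<^sub>0 J\<^sub>1. baxter_P J)"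
proof -
  define S where "S = {J. twin J \<and> twin_over J\<^sub>0 J\<^sub>1 \<le>\<^sub>B J \<and> J \<le>\<^sub>B twin_under J\<^sub>0 J\<^sub>1}"
  define I where "I = {\<sigma>. P_symbol \<sigma> = J\<^sub>0} \<times> {\<nu>. P_symbol \<nu> = J\<^sub>1}"
  let ?C = "{\<pi>. P_symbol \<pi> \<in> S}"
  have "?C \<subseteq> {\<pi>. length (letters \<pi>) = size (fst J\<^sub>0) + size (fst J\<^sub>1)}"
    by (auto simp: S_def interval_imp_length)
  then have finite_C: "finite ?C"
    by (rule finite_subset) (rule finite_perm_words_of_length)
  \<comment> \<open>Anything comparable under the Baxter order is by definition a P-symbol, so
    finiteness of \<open>S\<close> follows from that of \<open>?C\<close>.\<close>
  have "S \<subseteq> P_symbol ` ?C"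
  proof
    fix J assume "J \<in> S"
    then obtain \<pi> where "P_symbol \<pi> = J" unfolding S_def baxter_le_def by blast
    with \<open>J \<in> S\<close> show "J \<in> P_symbol ` ?C" by blast
  qed
  then have finite_S: "finite S"
    using finite_C finite_surj by blast
  have C_eq: "?C = (\<Union>(\<sigma>, \<nu>)\<in>I. shifted_shuffles \<sigma> \<nu>)"
    using shifted_shuffle_in_interval interval_imp_shifted_shuffle[OF assms]
    by (fastforce simp: S_def I_def twin_P_symbol)
  have "(baxter_P J\<^sub>0 :: 'k fqsym) \<cdot> baxter_P J\<^sub>1 =
      (\<Sum>(\<sigma>, \<nu>)\<in>I. \<Sum>\<pi>\<in>shifted_shuffles \<sigma> \<nu>. fqsym_F \<pi>)"
    unfolding baxter_P_mult I_def by (rule sum.cartesian_product)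
  also have "\<dots> = (\<Sum>x\<in>I. \<Sum>\<pi>\<in>(case x of (\<sigma>, \<nu>) \<Rightarrow> shifted_shuffles \<sigma> \<nu>). fqsym_F \<pi>)"
    by (rule sum.cong) auto
  also have "\<dots> = (\<Sum>\<pi>\<in>?C. fqsym_F \<pi>)"
    unfolding C_eq
  proof (rule sum.UNION_disjoint[symmetric])
    show "finite I" by (simp add: I_def finite_P_symbol_vimage)
    show "\<forall>x\<in>I. finite (case x of (\<sigma>, \<nu>) \<Rightarrow> shifted_shuffles \<sigma> \<nu>)"
      by (auto simp: finite_shifted_shuffles)
    show "\<forall>x\<in>I. \<forall>y\<in>I. x \<noteq> y \<longrightarrow> (case x of (\<sigma>, \<nu>) \<Rightarrow> shifted_shuffles \<sigma> \<nu>) \<inter>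
        (case y of (\<sigma>, \<nu>) \<Rightarrow> shifted_shuffles \<sigma> \<nu>) = {}"
      \<comment> \<open>All first factors have P-symbol \<open>J\<^sub>0\<close>, hence equal
        length.\<close>
      using shifted_shuffles_disjoint by (fastforce simp: I_def length_letters_eq)
  qed
  also have "\<dots> = (\<Sum>J\<in>S. \<Sum>\<pi> | \<pi> \<in> ?C \<and> P_symbol \<pi> = J. fqsym_F \<pi>)"
    by (rule sum.group[symmetric]) (use finite_C finite_S in auto)
  \<comment> \<open>Membership in \<open>?C\<close> depends on the P-symbol alone, so each group is
    a full fibre.\<close>
  also have "\<dots> = (\<Sum>J\<in>S. baxter_P J)"
    unfolding baxter_P_def by (intro sum.cong) auto
  finally show ?thesis unfolding S_def .
qed

end
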